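(* We have $$\sum_{f \in M_n} \omega_1(f) = q^n \log n + (A_1 - L(2))\, q^n + O\left(\frac{q^n}{n}\right) .$$ Moreover, for $k \geq 2$, as $n \to \infty$, we have $$\sum_{f \in M_n} \omega_k(f) = (L(k) - L(k+1))\, q^n + O\left(n \cdot q^{\frac{n}{k}}\right).$$
   Context: $\mathbb{F}_q$ is the finite field with $q$ elements ($q$ a fixed prime power), and $\mathbb{F}_q[t]$ is its polynomial ring. $P$ is the set of monic irreducible polynomials in $\mathbb{F}_q[t]$; for $n \ge 1$, $M_n$ is the set of monic polynomials of degree $n$ in $\mathbb{F}_q[t]$. For $f \in \mathbb{F}_q[t]$ nonzero, $|f| := q^{\deg(f)}$. For $l \in P$ and a monic $f$, $\nu_l(f)$ is the largest nonnegative integer with $l^{\nu_l(f)} \mid f$. For $k \ge 1$, $\omega_k(f)$ is the number of $l \in P$ with $\nu_l(f) = k$. $\pi_q(r)$ is the number of $l \in P$ with $\deg(l) = r$. $\gamma$ is the Euler--Mascheroni constant, $c_1 := \sum_{r=1}^{\infty} \left(\pi_q(r) - \frac{q^r}{r}\right) q^{-r}$, and $A_1 := \gamma + c_1$. For an integer $m \geq 2$, $L(m) := \sum_{l \in P} \frac{1}{|l|^m}$. $O$-estimates are as $n \to \infty$ with $q$ and $k$ fixed. *)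

theory Defs
  imports
    "HOL-Analysis.Analysis"
    "HOL-Computational_Algebra.Polynomial_Factorial"
    "HOL-Library.Landau_Symbols"
begin

text \<open>
  The finite field with \<open>q\<close> elements is a type \<open>'a\<close> of class \<open>field\<close> and \<open>finite\<close>, with
  \<open>q = CARD('a)\<close>. Constants depending on the field only take it as an argument \<open>TYPE('a)\<close>.
\<close>

definition monic_irreducibles :: "'a::{field,finite} poly set" where
  "monic_irreducibles = {l. irreducible l \<and> lead_coeff l = 1}"

definition monic_of_degree :: "nat \<Rightarrow> 'a::{field,finite} poly set" where
  "monic_of_degree n = {f. lead_coeff f = 1 \<and> degree f = n}"

definition poly_abs :: "'a::{field,finite} poly \<Rightarrow> real" where
  "poly_abs f = real CARD('a) ^ degree f"

text \<open>
  \<open>multiplicity\<close> from the library would force the coefficient field into a type class with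
  chosen gcd and normalization operations, so the valuation is defined directly.
  The maximum exists for \<open>l\<close> irreducible and \<open>f \<noteq> 0\<close>.
\<close>

definition nu :: "'a::{field,finite} poly \<Rightarrow> 'a poly \<Rightarrow> nat" where
  "nu l f = Max {v. l ^ v dvd f}"

text \<open>The intended use is \<open>k \<ge> 1\<close> and \<open>f \<noteq> 0\<close>; the set counted is then finite.\<close>

definition omega :: "nat \<Rightarrow> 'a::{field,finite} poly \<Rightarrow> nat" where
  "omega k f = card {l \<in> monic_irreducibles. nu l f = k}"

definition irreducible_count :: "'a::{field,finite} itself \<Rightarrow> nat \<Rightarrow> nat" where
  "irreducible_count _ r = card {l \<in> (monic_irreducibles :: 'a poly set). degree l = r}"

text \<open>The series starts at \<open>r = 1\<close>, hence the shift by \<open>Suc\<close>.\<close>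

definition c1 :: "'a::{field,finite} itself \<Rightarrow> real" where
  "c1 T = (\<Sum>i. let r = Suc i; q = real CARD('a) in
     (real (irreducible_count T r) - q ^ r / real r) / q ^ r)"

definition A1 :: "'a::{field,finite} itself \<Rightarrow> real" where
  "A1 T = euler_mascheroni + c1 T"

definition L :: "'a::{field,finite} itself \<Rightarrow> nat \<Rightarrow> real" where
  "L _ m = (\<Sum>\<^sub>\<infinity>l\<in>(monic_irreducibles :: 'a poly set). 1 / poly_abs l ^ m)"

end

theory Submission
  imports Defs
begin

text \<open>
  Write \<open>q\<close> for the size of the field and \<open>\<pi> d\<close> for the number of monic irreducibles of degree \<open>d\<close>.
  For \<open>k \<ge> 1\<close> and \<open>f \<noteq> 0\<close>, \<open>omega k f\<close> counts the monic irreducibles \<open>l\<close> with \<open>l ^ k\<close> but not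
  \<open>l ^ Suc k\<close> dividing \<open>f\<close>. A monic \<open>g\<close> of degree \<open>e \<le> n\<close> has exactly \<open>q ^ (n - e)\<close>
  monic multiples of degree \<open>n\<close>, and none if \<open>e > n\<close>. Hence the sum of \<open>omega k\<close> over monic polynomials
  of degree \<open>n\<close> is exactly \<open>E k n - E (k + 1) n\<close>, where
  \<open>E m n = q ^ n * (\<Sum>d\<le>n div m. \<pi> d / q ^ (m * d))\<close> (lemmas \<open>sum_omega\<close> and \<open>sum_multiples_eq\<close>).

  For \<open>m \<ge> 2\<close> the sum in \<open>E m n\<close> is a partial sum of a series for \<open>L m\<close>, and the trivial bound
  \<open>\<pi> d \<le> q ^ d\<close> makes the tail geometric, so that \<open>E m n = L m * q ^ n + O(q\<^bsup>n/m\<^esup>)\<close>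
  (lemma \<open>sum_multiples_approx\<close>). This settles \<open>k \<ge> 2\<close>, even without the factor \<open>n\<close> in the error term.

  For \<open>k = 1\<close> the sum \<open>(\<Sum>d\<le>n. \<pi> d / q ^ d)\<close> is split as the harmonic number of \<open>n\<close> plus a partial sum
  of the series \<open>c1\<close>. Its tail is \<open>O(q\<^bsup>-n/2\<^esup>)\<close> by the prime polynomial theorem
  \<open>\<pi> d = q ^ d / d + O(q\<^bsup>d/2\<^esup>)\<close> (lemma \<open>irreducible_count_approx\<close>). That in turn follows from
  \<open>(\<Sum>d | d dvd n. d * \<pi> d) = q ^ n\<close> (lemma \<open>sum_divisors_irreducible_count\<close>), which is proved without
  field extensions or generating functions, by Chebyshev's device: summing \<open>deg f\<close>, the
  sum of \<open>nu l f * deg l\<close>, over all monic \<open>f\<close> of degree \<open>n\<close> evaluates a convolution for every \<open>n\<close>,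
  and comparing consecutive \<open>n\<close> isolates the divisor sum.
\<close>

section \<open>Counting monic polynomials\<close>

lemma monic_degree_0_imp_1:
  fixes f :: "'a::{field,finite} poly"
  assumes "lead_coeff f = 1" "degree f = 0"
  shows "f = 1"
  using assms by (metis degree_0_id of_nat_1 one_pCons)

lemma monic_of_degree_0: "monic_of_degree 0 = {1 :: 'a::{field,finite} poly}"
  by (auto simp: monic_of_degree_def intro: monic_degree_0_imp_1)

lemma monic_of_degree_Suc:
  "monic_of_degree (Suc n)
     = (\<lambda>(a, p). pCons a p) ` ((UNIV :: 'a::{field,finite} set) \<times> monic_of_degree n)"
proof (intro equalityI subsetI)
  fix f :: "'a poly" assume f: "f \<in> monic_of_degree (Suc n)"
  obtain a p where ap: "f = pCons a p" by (cases f)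
  with f have "p \<noteq> 0" by (auto simp: monic_of_degree_def)
  with f ap have "p \<in> monic_of_degree n" by (auto simp: monic_of_degree_def)
  with ap show "f \<in> (\<lambda>(a, p). pCons a p) ` (UNIV \<times> monic_of_degree n)" by auto
next
  fix f :: "'a poly" assume "f \<in> (\<lambda>(a, p). pCons a p) ` (UNIV \<times> monic_of_degree n)"
  then obtain a p where ap: "f = pCons a p" "p \<in> monic_of_degree n" by auto
  then have "p \<noteq> 0" by (auto simp: monic_of_degree_def)
  with ap show "f \<in> monic_of_degree (Suc n)" by (auto simp: monic_of_degree_def)
qed

lemma finite_monic_of_degree [simp]: "finite (monic_of_degree n :: 'a::{field,finite} poly set)"
  by (induction n) (simp_all add: monic_of_degree_0 monic_of_degree_Suc)

lemma card_monic_of_degree: "card (monic_of_degree n :: 'a::{field,finite} poly set) = CARD('a) ^ n"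
proof (induction n)
  case 0
  show ?case by (simp add: monic_of_degree_0)
next
  case (Suc n)
  have "inj_on (\<lambda>(a, p). pCons a p) ((UNIV :: 'a set) \<times> monic_of_degree n)"
    by (auto simp: inj_on_def)
  then show ?case
    using Suc by (simp add: monic_of_degree_Suc card_image card_cartesian_product)
qed

lemma card_monic_multiples:
  fixes g :: "'a::{field,finite} poly"
  assumes "lead_coeff g = 1"
  shows "card {f \<in> monic_of_degree n. g dvd f}
           = (if degree g \<le> n then CARD('a) ^ (n - degree g) else 0)"
proof (cases "degree g \<le> n")
  case True
  have g0: "g \<noteq> 0" using assms by auto
  have "{f \<in> monic_of_degree n. g dvd f} = (\<lambda>h. g * h) ` monic_of_degree (n - degree g)"
  proof (intro equalityI subsetI)
    fix f assume "f \<in> {f \<in> monic_of_degree n. g dvd f}"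
    then obtain h where h: "f = g * h" "lead_coeff f = 1" "degree f = n"
      unfolding monic_of_degree_def by blast
    then have "h \<noteq> 0" by auto
    with h g0 have "degree h = n - degree g" by (auto simp: degree_mult_eq)
    moreover have "lead_coeff h = 1" using h(1,2) assms by (simp add: lead_coeff_mult)
    ultimately have "h \<in> monic_of_degree (n - degree g)" by (simp add: monic_of_degree_def)
    then show "f \<in> (\<lambda>h. g * h) ` monic_of_degree (n - degree g)"
      using h(1) by blast
  next
    fix f assume "f \<in> (\<lambda>h. g * h) ` monic_of_degree (n - degree g)"
    then obtain h where h: "f = g * h" "lead_coeff h = 1" "degree h = n - degree g"
      unfolding monic_of_degree_def by blast
    then have "h \<noteq> 0" by auto
    with h g0 True have "degree f = n" by (simp add: degree_mult_eq)
    moreover have "lead_coeff f = 1" unfolding h(1) using h(2) assms by (simp only: lead_coeff_mult mult_1)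
    ultimately show "f \<in> {f \<in> monic_of_degree n. g dvd f}"
      using h(1) by (simp add: monic_of_degree_def)
  qed
  moreover have "inj_on (\<lambda>h. g * h) (monic_of_degree (n - degree g))"
    using g0 by (auto simp: inj_on_def)
  ultimately show ?thesis using True by (simp add: card_image card_monic_of_degree)
next
  case False
  have "{f \<in> monic_of_degree n. g dvd f} = {}"
  proof safe
    fix f :: "'a poly" assume f: "f \<in> monic_of_degree n" "g dvd f"
    then have "f \<noteq> 0" "degree f = n" by (auto simp: monic_of_degree_def)
    with f False show "f \<in> {}" using dvd_imp_degree_le[of g f] by auto
  qed
  then show ?thesis using False by (simp only: card.empty if_False)
qed

section \<open>Valuations at monic irreducible polynomials\<close>

lemma monic_irreducible_degree_pos:
  "l \<in> monic_irreducibles \<Longrightarrow> degree l > 0"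
  unfolding monic_irreducibles_def
  by (auto simp: irreducible_def is_unit_iff_degree)

lemma monic_irreducible_power:
  fixes l :: "'a::{field,finite} poly"
  assumes "l \<in> monic_irreducibles"
  shows "lead_coeff (l ^ k) = 1" and "degree (l ^ k) = k * degree l"
proof -
  have "l \<noteq> 0" "lead_coeff l = 1" using assms by (auto simp: monic_irreducibles_def)
  then show "lead_coeff (l ^ k) = 1" and "degree (l ^ k) = k * degree l"
    by (simp only: lead_coeff_power power_one) (simp add: degree_power_eq \<open>l \<noteq> 0\<close>)
qed

lemma monic_irreducible_dvd_imp_eq:
  fixes l l' :: "'a::{field,finite} poly"
  assumes "l \<in> monic_irreducibles" "l' \<in> monic_irreducibles" "l' dvd l"
  shows "l' = l"
proof -
  obtain c where c: "l = l' * c" using assms(3) by auto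
  have "\<not> l' dvd 1" "irreducible l" "lead_coeff l = 1" "lead_coeff l' = 1"
    using assms by (auto simp: monic_irreducibles_def irreducible_def)
  with c have "c dvd 1" using irreducibleD[of l l' c] by blast
  moreover have "lead_coeff c = 1"
    using c \<open>lead_coeff l = 1\<close> \<open>lead_coeff l' = 1\<close> by (simp add: lead_coeff_mult)
  moreover from this have "c \<noteq> 0" by auto
  ultimately have "c = 1"
    by (intro monic_degree_0_imp_1) (simp_all add: is_unit_iff_degree)
  with c show ?thesis by simp
qed

lemma finite_monic_irreducibles_le:
  "finite {l \<in> monic_irreducibles :: 'a::{field,finite} poly set. degree l \<le> n}"
proof (rule finite_subset)
  show "{l \<in> monic_irreducibles :: 'a poly set. degree l \<le> n} \<subseteq> (\<Union>d\<in>{..n}. monic_of_degree d)"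
    by (auto simp: monic_irreducibles_def monic_of_degree_def)
qed auto

lemma finite_monic_irreducibles_eq:
  "finite {l \<in> monic_irreducibles :: 'a::{field,finite} poly set. degree l = n}"
  by (rule finite_subset[OF _ finite_monic_irreducibles_le[of n]]) auto

lemma power_dvd_degree_le:
  fixes l f :: "'a::{field,finite} poly"
  assumes "l \<in> monic_irreducibles" "f \<noteq> 0" "l ^ v dvd f"
  shows "v \<le> degree f"
proof -
  have "v * degree l \<le> degree f"
    using dvd_imp_degree_le[OF assms(3,2)] monic_irreducible_power(2)[OF assms(1)] by simp
  moreover have "v * 1 \<le> v * degree l"
    using monic_irreducible_degree_pos[OF assms(1)] by (intro mult_left_mono) auto
  ultimately show ?thesis by linarith
qed

lemma power_dvd_iff_le_nu:
  fixes l f :: "'a::{field,finite} poly"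
  assumes "l \<in> monic_irreducibles" "f \<noteq> 0"
  shows "l ^ v dvd f \<longleftrightarrow> v \<le> nu l f"
proof -
  have fin: "finite {v. l ^ v dvd f}"
    by (rule finite_subset[of _ "{..degree f}"]) (use power_dvd_degree_le[OF assms] in auto)
  have "0 \<in> {v. l ^ v dvd f}" by simp
  then have "nu l f \<in> {v. l ^ v dvd f}"
    unfolding nu_def by (intro Max_in fin) blast
  moreover have "v \<le> nu l f" if "l ^ v dvd f"
    unfolding nu_def using that fin by (intro Max_ge) auto
  ultimately show ?thesis using power_le_dvd[of l "nu l f" f v] by blast
qed

lemma nu_eqI:
  fixes l f :: "'a::{field,finite} poly"
  assumes "l \<in> monic_irreducibles" "f \<noteq> 0" "\<And>v. l ^ v dvd f \<longleftrightarrow> v \<le> n"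
  shows "nu l f = n"
  using power_dvd_iff_le_nu[OF assms(1,2)] assms(3) by (metis dual_order.refl le_antisym)

lemma nu_mult_self:
  fixes l g :: "'a::{field,finite} poly"
  assumes l: "l \<in> monic_irreducibles" and g: "g \<noteq> 0"
  shows "nu l (l * g) = Suc (nu l g)"
proof (rule nu_eqI[OF l])
  have l0: "l \<noteq> 0" using monic_irreducible_degree_pos[OF l] by auto
  with g show "l * g \<noteq> 0" by simp
  show "l ^ v dvd l * g \<longleftrightarrow> v \<le> Suc (nu l g)" for v
    using l0 power_dvd_iff_le_nu[OF l g] by (cases v) auto
qed

lemma nu_mult_other:
  fixes l l' g :: "'a::{field,finite} poly"
  assumes l: "l \<in> monic_irreducibles" and l': "l' \<in> monic_irreducibles"
    and "l' \<noteq> l" and g: "g \<noteq> 0"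
  shows "nu l' (l * g) = nu l' g"
proof (rule nu_eqI[OF l'])
  have l0: "l \<noteq> 0" "l' \<noteq> 0"
    using monic_irreducible_degree_pos[OF l] monic_irreducible_degree_pos[OF l'] by auto
  with g show "l * g \<noteq> 0" by simp
  have prime: "prime_elem l'"
    using l' field_poly_irreducible_imp_prime[of l'] by (simp add: monic_irreducibles_def)
  have ndvd: "\<not> l' dvd l" using monic_irreducible_dvd_imp_eq[OF l l'] \<open>l' \<noteq> l\<close> by auto
  have "l' ^ v dvd h" if "l' ^ v dvd l * h" for v h
    using that
  proof (induction v arbitrary: h)
    case (Suc v)
    have "l' dvd l * h" using dvd_trans[OF _ Suc.prems, of l'] by simp
    then have "l' dvd h" using prime_elem_dvd_multD[OF prime, of l h] ndvd by blast
    then obtain h' where h': "h = l' * h'" by auto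
    have "l' * l' ^ v dvd l' * (l * h')" using Suc.prems by (simp only: power_Suc h' mult.left_commute[of l])
    then have "l' ^ v dvd l * h'" using l0(2) by (simp only: dvd_mult_cancel_left) simp
    then have "l' ^ v dvd h'" by (rule Suc.IH)
    then show ?case by (simp add: h')
  qed simp
  then show "l' ^ v dvd l * g \<longleftrightarrow> v \<le> nu l' g" for v
    using power_dvd_iff_le_nu[OF l' g, of v] dvd_mult[of "l' ^ v" g l] by blast
qed

lemma exists_monic_irreducible_divisor:
  fixes f :: "'a::{field,finite} poly"
  assumes "degree f > 0"
  shows "\<exists>l\<in>monic_irreducibles. l dvd f"
  using assms
proof (induction "degree f" arbitrary: f rule: less_induct)
  case less
  then have f0: "f \<noteq> 0" by auto
  show ?case
  proof (cases "irreducible f")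
    case True
    define c where "c = inverse (lead_coeff f)"
    have c0: "c \<noteq> 0" using f0 by (simp add: c_def)
    have "is_unit [:c:]" using c0 by (simp add: is_unit_const_poly_iff dvd_field_iff)
    then have "irreducible (smult c f)" using True irreducible_mult_unit_left[of "[:c:]" f] by simp
    moreover have "lead_coeff (smult c f) = 1" using f0 by (simp add: c_def)
    ultimately have "smult c f \<in> monic_irreducibles" by (simp add: monic_irreducibles_def)
    moreover have "smult c f dvd f" using c0 by (simp add: smult_dvd)
    ultimately show ?thesis by blast
  next
    case False
    have "\<not> f dvd 1" using less.prems f0 by (simp add: is_unit_iff_degree)
    with False f0 obtain a b where ab: "f = a * b" "\<not> a dvd 1" "\<not> b dvd 1"
      by (auto simp: irreducible_def)
    then have "a \<noteq> 0" "b \<noteq> 0" using f0 by auto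
    with ab have "degree a > 0" "degree b > 0" by (auto simp: is_unit_iff_degree)
    moreover from this have "degree a < degree f"
      using ab(1) \<open>a \<noteq> 0\<close> \<open>b \<noteq> 0\<close> by (simp add: degree_mult_eq)
    ultimately obtain l where "l \<in> monic_irreducibles" "l dvd a" using less.hyps by blast
    moreover from this have "l dvd f" using ab(1) by (simp add: dvd_mult2)
    ultimately show ?thesis by blast
  qed
qed

text \<open>
  This is all that is needed of unique factorization. The bound \<open>n\<close> only serves to make the
  index set finite; irreducibles of degree larger than \<open>degree f\<close> have valuation \<open>0\<close>.
\<close>

lemma degree_eq_sum_nu:
  fixes f :: "'a::{field,finite} poly"
  assumes "lead_coeff f = 1" "degree f \<le> n"
  shows "degree f = (\<Sum>l\<in>{l \<in> monic_irreducibles. degree l \<le> n}. degree l * nu l f)"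
  using assms
proof (induction "degree f" arbitrary: f rule: less_induct)
  case less
  let ?S = "{l \<in> monic_irreducibles :: 'a poly set. degree l \<le> n}"
  show ?case
  proof (cases "degree f = 0")
    case True
    then have "f = 1" using less.prems monic_degree_0_imp_1 by blast
    have "nu l (1 :: 'a poly) = 0" if "l \<in> ?S" for l
      using power_dvd_iff_le_nu[of l 1 "nu l 1"] power_dvd_degree_le[of l 1 "nu l 1"] that by auto
    then show ?thesis using \<open>f = 1\<close> by simp
  next
    case False
    then obtain l where l: "l \<in> monic_irreducibles" "l dvd f"
      using exists_monic_irreducible_divisor by blast
    then obtain g where g: "f = l * g" by auto
    have f0: "f \<noteq> 0" using less.prems by auto
    then have "g \<noteq> 0" "l \<noteq> 0" using g by auto
    then have deg: "degree f = degree l + degree g" using g by (simp add: degree_mult_eq)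
    have lc: "lead_coeff g = 1"
      using less.prems(1) l(1) by (simp add: g lead_coeff_mult monic_irreducibles_def)
    have lpos: "degree l > 0" using monic_irreducible_degree_pos l by auto
    have lS: "l \<in> ?S" using l deg less.prems by auto
    have IH: "degree g = (\<Sum>l\<in>?S. degree l * nu l g)"
      using lpos deg less.prems lc by (intro less.hyps) auto
    have "(\<Sum>m\<in>?S. degree m * nu m f)
            = (\<Sum>m\<in>?S. (if m = l then degree l else 0) + degree m * nu m g)"
      using nu_mult_self[OF l(1) \<open>g \<noteq> 0\<close>] nu_mult_other[OF l(1) _ _ \<open>g \<noteq> 0\<close>]
      by (intro sum.cong) (auto simp: g)
    also have "\<dots> = degree l + (\<Sum>m\<in>?S. degree m * nu m g)"
      using sum.delta[OF finite_monic_irreducibles_le[of n], of l "\<lambda>_. degree l"] lS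
      by (simp add: sum.distrib)
    finally show ?thesis using IH deg by simp
  qed
qed

text \<open>\<open>card_monic_multiples\<close> for a power of an irreducible, in a form suited to exchanging sums.\<close>

lemma sum_dvd_indicator:
  fixes l :: "'a::{field,finite} poly"
  assumes l: "l \<in> monic_irreducibles"
  shows "(\<Sum>f\<in>monic_of_degree n. if l ^ k dvd f then 1 else 0)
           = (if k * degree l \<le> n then real CARD('a) ^ (n - k * degree l) else 0)"
proof -
  have "(\<Sum>f\<in>monic_of_degree n. if l ^ k dvd f then 1 else 0)
          = real (card {f \<in> monic_of_degree n. l ^ k dvd f})"
    by (simp flip: sum.inter_filter)
  also have "\<dots> = (if k * degree l \<le> n then real CARD('a) ^ (n - k * degree l) else 0)"
    by (simp only: card_monic_multiples[OF monic_irreducible_power(1)[OF l]]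
        monic_irreducible_power(2)[OF l] of_nat_power of_nat_0 if_distrib[of real])
  finally show ?thesis .
qed

section \<open>The prime polynomial theorem\<close>

lemma irreducible_count_0 [simp]: "irreducible_count TYPE('a::{field,finite}) 0 = 0"
  unfolding irreducible_count_def
  using monic_irreducible_degree_pos by (fastforce simp: card_eq_0_iff)

lemma sum_monic_irreducibles_by_degree:
  fixes g :: "nat \<Rightarrow> real"
  shows "(\<Sum>l\<in>{l \<in> monic_irreducibles :: 'a::{field,finite} poly set. degree l \<le> n}. g (degree l))
           = (\<Sum>d=1..n. real (irreducible_count TYPE('a) d) * g d)"
proof -
  let ?S = "{l \<in> monic_irreducibles :: 'a poly set. degree l \<le> n}"
  have "(\<Sum>l\<in>?S. g (degree l)) = (\<Sum>d\<in>{..n}. \<Sum>l\<in>{l \<in> ?S. degree l = d}. g (degree l))"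
    by (subst sum.group) (auto intro: finite_monic_irreducibles_le)
  also have "\<dots> = (\<Sum>d\<in>{..n}. real (irreducible_count TYPE('a) d) * g d)"
  proof (intro sum.cong refl)
    fix d assume "d \<in> {..n}"
    then have "{l \<in> ?S. degree l = d} = {l \<in> monic_irreducibles. degree l = d}" by auto
    then show "(\<Sum>l\<in>{l \<in> ?S. degree l = d}. g (degree l)) = real (irreducible_count TYPE('a) d) * g d"
      by (simp add: irreducible_count_def)
  qed
  also have "\<dots> = (\<Sum>d=1..n. real (irreducible_count TYPE('a) d) * g d)"
    by (intro sum.mono_neutral_right) (auto simp: not_less_eq_eq)
  finally show ?thesis .
qed

text \<open>
  The sum over \<open>d dvd m\<close> is the sum of the von Mangoldt function over monic polynomials of
  degree \<open>m\<close>: the power \<open>l ^ (m div d)\<close> of an irreducible \<open>l\<close> of degree \<open>d\<close> contributes \<open>d\<close>.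
  Both sides are the sum of the degrees of all monic polynomials of degree \<open>n\<close>.
\<close>

lemma mangoldt_convolution:
  "(\<Sum>m=1..n. real CARD('a::{field,finite}) ^ (n - m)
       * (\<Sum>d | d dvd m. real d * real (irreducible_count TYPE('a) d)))
     = real n * real CARD('a) ^ n"
proof -
  define q where "q = real CARD('a)"
  define \<pi> where "\<pi> d = real (irreducible_count TYPE('a) d)" for d
  let ?S = "{l \<in> monic_irreducibles :: 'a poly set. degree l \<le> n}"
  let ?M = "monic_of_degree n :: 'a poly set"
  have nu: "real (nu l f) = (\<Sum>k=1..n. if l ^ k dvd f then 1 else 0)" if "l \<in> ?S" "f \<in> ?M" for l f
  proof -
    have f: "f \<noteq> 0" "degree f = n" using that(2) by (auto simp: monic_of_degree_def)
    have l: "l \<in> monic_irreducibles" using that(1) by auto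
    have "nu l f \<le> n"
      using power_dvd_degree_le[OF l f(1), of "nu l f"] power_dvd_iff_le_nu[OF l f(1)] f(2) by auto
    then have eq: "{1..n} \<inter> {k. k \<le> nu l f} = {1..nu l f}" by auto
    have "(\<Sum>k=1..n. if l ^ k dvd f then 1 else 0 :: real) = (\<Sum>k=1..n. if k \<le> nu l f then 1 else 0)"
      by (simp only: power_dvd_iff_le_nu[OF l f(1)])
    also have "\<dots> = real (nu l f)" by (subst sum.If_cases) (simp_all only: finite_atLeastAtMost eq, simp)
    finally show ?thesis by simp
  qed
  have "real n * q ^ n = (\<Sum>f\<in>?M. real (degree f))"
  proof -
    have "(\<Sum>f\<in>?M. real (degree f)) = (\<Sum>f\<in>?M. real n)"
      by (intro sum.cong) (auto simp: monic_of_degree_def)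
    then show ?thesis by (simp add: card_monic_of_degree q_def)
  qed
  also have "\<dots> = (\<Sum>f\<in>?M. \<Sum>l\<in>?S. real (degree l) * real (nu l f))"
  proof (intro sum.cong refl)
    fix f assume "f \<in> ?M"
    then have "lead_coeff f = 1" "degree f \<le> n" by (auto simp: monic_of_degree_def)
    from degree_eq_sum_nu[OF this]
    show "real (degree f) = (\<Sum>l\<in>?S. real (degree l) * real (nu l f))"
      by (simp flip: of_nat_mult of_nat_sum)
  qed
  also have "\<dots> = (\<Sum>l\<in>?S. \<Sum>f\<in>?M. real (degree l) * (\<Sum>k=1..n. if l ^ k dvd f then 1 else 0))"
    by (subst sum.swap) (intro sum.cong refl, simp add: nu)
  also have "\<dots> = (\<Sum>l\<in>?S. real (degree l) * (\<Sum>k=1..n. \<Sum>f\<in>?M. if l ^ k dvd f then 1 else 0))"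
    by (intro sum.cong refl, simp only: sum_distrib_left[symmetric], subst sum.swap, rule refl)
  also have "\<dots> = (\<Sum>l\<in>?S. real (degree l) *
                    (\<Sum>k=1..n. if k * degree l \<le> n then q ^ (n - k * degree l) else 0))"
    by (intro sum.cong refl arg_cong2[of _ _ _ _ "(*)"])
       (simp add: sum_dvd_indicator q_def)
  also have "\<dots> = (\<Sum>d=1..n. \<pi> d * (real d * (\<Sum>k=1..n. if k * d \<le> n then q ^ (n - k * d) else 0)))"
    unfolding \<pi>_def by (rule sum_monic_irreducibles_by_degree)
  \<comment> \<open>Sort the powers \<open>l ^ k\<close> by their degree \<open>m = k * d\<close>.\<close>
  also have "\<dots> = (\<Sum>d=1..n. \<pi> d * (real d * (\<Sum>m=1..n. if d dvd m then q ^ (n - m) else 0)))"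
  proof (rule sum.cong[OF refl])
    fix d assume d: "d \<in> {1..n}"
    have "(\<Sum>k\<in>{k \<in> {1..n}. k * d \<le> n}. q ^ (n - k * d)) = (\<Sum>m\<in>{m \<in> {1..n}. d dvd m}. q ^ (n - m))"
    proof (rule sum.reindex_bij_witness[of _ "\<lambda>m. m div d" "\<lambda>k. k * d"])
      fix m assume m: "m \<in> {m \<in> {1..n}. d dvd m}"
      then have "d \<le> m" "m div d \<le> m" using d by (auto dest: dvd_imp_le)
      then show "m div d \<in> {k \<in> {1..n}. k * d \<le> n}"
        using m d order_trans[of "m div d" m n] by (auto simp: Suc_le_eq div_greater_zero_iff)
    qed (use d in auto)
    then show "\<pi> d * (real d * (\<Sum>k=1..n. if k * d \<le> n then q ^ (n - k * d) else 0))
             = \<pi> d * (real d * (\<Sum>m=1..n. if d dvd m then q ^ (n - m) else 0))"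
      by (simp only: sum.inter_filter[OF finite_atLeastAtMost])
  qed
  also have "\<dots> = (\<Sum>m=1..n. \<Sum>d=1..n. if d dvd m then q ^ (n - m) * (real d * \<pi> d) else 0)"
    by (subst sum.swap, simp only: sum_distrib_left, intro sum.cong refl) (simp split: if_split)
  also have "\<dots> = (\<Sum>m=1..n. q ^ (n - m) * (\<Sum>d | d dvd m. real d * \<pi> d))"
  proof (intro sum.cong refl)
    fix m assume m: "m \<in> {1..n}"
    then have "{d \<in> {1..n}. d dvd m} = {d. d dvd m}"
      by (auto simp: Suc_le_eq dest: dvd_imp_le dvd_pos_nat)
    then show "(\<Sum>d=1..n. if d dvd m then q ^ (n - m) * (real d * \<pi> d) else 0)
             = q ^ (n - m) * (\<Sum>d | d dvd m. real d * \<pi> d)"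
      by (simp only: sum.inter_filter[OF finite_atLeastAtMost, symmetric] sum_distrib_left)
  qed
  finally show ?thesis by (simp add: q_def \<pi>_def)
qed

text \<open>
  The convolution identity at \<open>n\<close> minus \<open>q\<close> times the identity at \<open>n - 1\<close> leaves only the term \<open>m = n\<close>.
\<close>

lemma sum_divisors_irreducible_count:
  assumes "n > 0"
  shows "(\<Sum>d | d dvd n. real d * real (irreducible_count TYPE('a::{field,finite}) d))
           = real CARD('a) ^ n"
proof -
  define q where "q = real CARD('a)"
  define \<Lambda> where "\<Lambda> m = (\<Sum>d | d dvd m. real d * real (irreducible_count TYPE('a) d))" for m
  have conv: "(\<Sum>m=1..n. q ^ (n - m) * \<Lambda> m) = real n * q ^ n" for n
    unfolding q_def \<Lambda>_def by (rule mangoldt_convolution)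
  obtain k where k: "n = Suc k" using assms by (cases n) auto
  have "real n * q ^ n = (\<Sum>m=1..k. q ^ (Suc k - m) * \<Lambda> m) + \<Lambda> n"
    using conv[of n] by (simp add: k)
  also have "(\<Sum>m=1..k. q ^ (Suc k - m) * \<Lambda> m) = q * (\<Sum>m=1..k. q ^ (k - m) * \<Lambda> m)"
    by (auto simp: sum_distrib_left Suc_diff_le intro!: sum.cong)
  also have "\<dots> = q * (real k * q ^ k)" by (simp only: conv)
  finally show ?thesis by (simp add: k \<Lambda>_def q_def algebra_simps)
qed

lemma card_field_ge_2: "real CARD('a::{field,finite}) \<ge> 2"
proof -
  have "card {0, 1 :: 'a} \<le> CARD('a)" by (intro card_mono) auto
  then show ?thesis by simp
qed

lemma irreducible_count_le: "real (irreducible_count TYPE('a::{field,finite}) d) \<le> real CARD('a) ^ d"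
proof (cases "d = 0")
  case False
  let ?\<pi> = "\<lambda>d. real (irreducible_count TYPE('a) d)"
  have "real d * ?\<pi> d \<le> (\<Sum>e | e dvd d. real e * ?\<pi> e)"
    using False by (intro member_le_sum) auto
  also have "\<dots> = real CARD('a) ^ d" using False sum_divisors_irreducible_count[where 'a = 'a] by simp
  finally have "real d * ?\<pi> d \<le> real CARD('a) ^ d" .
  moreover have "1 * ?\<pi> d \<le> real d * ?\<pi> d" using False by (intro mult_right_mono) auto
  ultimately show ?thesis by linarith
qed simp

text \<open>
  The proper divisors of \<open>n\<close> are at most \<open>n div 2\<close>, so together they contribute
  \<open>O(q\<^bsup>n/2\<^esup>)\<close> to the divisor sum for \<open>q\<^sup>n\<close>.
\<close>

lemma irreducible_count_approx:
  assumes "n > 0"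
  shows "\<bar>real (irreducible_count TYPE('a::{field,finite}) n) - real CARD('a) ^ n / real n\<bar>
           \<le> 2 * sqrt (real CARD('a)) ^ n"
proof -
  define q where "q = real CARD('a)"
  define \<pi> where "\<pi> d = real (irreducible_count TYPE('a) d)" for d
  have q: "q \<ge> 2" unfolding q_def by (rule card_field_ge_2)
  have divsum: "(\<Sum>d | d dvd d'. real d * \<pi> d) = q ^ d'" if "d' > 0" for d'
    unfolding \<pi>_def q_def by (rule sum_divisors_irreducible_count[OF that])
  have le: "real d * \<pi> d \<le> q ^ d" if "d > 0" for d
  proof -
    have "real d * \<pi> d \<le> (\<Sum>e | e dvd d. real e * \<pi> e)"
      using that by (intro member_le_sum) (auto simp: \<pi>_def)
    then show ?thesis using divsum[OF that] by simp
  qed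
  have geo: "(\<Sum>d\<le>m. q ^ d) \<le> 2 * q ^ m" for m
  proof (induction m)
    case (Suc m)
    have "2 * q ^ m \<le> q * q ^ m" using q by (intro mult_right_mono) auto
    with Suc show ?case by simp
  qed simp
  define R where "R = (\<Sum>d | d dvd n \<and> d \<noteq> n. real d * \<pi> d)"
  have "{d. d dvd n} = insert n {d. d dvd n \<and> d \<noteq> n}" by auto
  moreover have "finite {d. d dvd n \<and> d \<noteq> n}"
    by (rule finite_subset[of _ "{d. d dvd n}"]) (use assms in auto)
  ultimately have split: "q ^ n = real n * \<pi> n + R"
    using divsum[OF assms] by (simp add: R_def)
  have sub: "{d. d dvd n \<and> d \<noteq> n} \<subseteq> {..n div 2}"
  proof safe
    fix d assume d: "d dvd n" "d \<noteq> n"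
    then obtain c where c: "n = d * c" by auto
    with d assms have "c \<noteq> 0" "c \<noteq> 1" by auto
    then have "d * 2 \<le> d * c" by (intro mult_left_mono) auto
    with c show "d \<le> n div 2" by (simp add: less_eq_div_iff_mult_less_eq)
  qed
  have "R \<le> (\<Sum>d | d dvd n \<and> d \<noteq> n. q ^ d)"
    unfolding R_def using assms by (intro sum_mono le) (auto intro: dvd_pos_nat)
  also have "\<dots> \<le> (\<Sum>d\<le>n div 2. q ^ d)"
    using sub q by (intro sum_mono2) auto
  also have "\<dots> \<le> 2 * q ^ (n div 2)" by (rule geo)
  also have "q ^ (n div 2) = sqrt q ^ (2 * (n div 2))"
    using q by (simp add: power_mult)
  also have "\<dots> \<le> sqrt q ^ n" using q by (intro power_increasing) auto
  finally have R: "R \<le> 2 * sqrt q ^ n" by simp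
  have R0: "R \<ge> 0" unfolding R_def \<pi>_def by (intro sum_nonneg) auto
  have "\<pi> n - q ^ n / real n = - (R / real n)"
    using assms split by (simp add: field_simps)
  then have "\<bar>\<pi> n - q ^ n / real n\<bar> = R / real n" using R0 by simp
  also have "\<dots> \<le> R / 1" using assms R0 by (intro divide_left_mono) auto
  finally show ?thesis using R by (simp add: \<pi>_def q_def)
qed

section \<open>The constants as series over degrees\<close>

lemma geometric_tail_bound:
  fixes a :: "nat \<Rightarrow> real"
  assumes x: "0 \<le> x" "x < 1" and a: "\<And>d. \<bar>a d\<bar> \<le> C * x ^ d"
  shows "summable a" and "\<bar>suminf a - (\<Sum>d<N. a d)\<bar> \<le> C * x ^ N / (1 - x)"
proof -
  have geo: "summable (\<lambda>d. C * x ^ d)" using x by (intro summable_mult summable_geometric) auto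
  show sa: "summable a" by (rule summable_comparison_test'[OF geo]) (use a in auto)
  have "(\<lambda>i. C * x ^ N * x ^ i) sums (C * x ^ N * (1 / (1 - x)))"
    using x by (intro sums_mult geometric_sums) auto
  then have tail: "(\<lambda>i. C * x ^ (i + N)) sums (C * x ^ N / (1 - x))"
    by (simp add: power_add mult_ac)
  have "\<bar>suminf a - (\<Sum>d<N. a d)\<bar> = norm (\<Sum>i. a (i + N))"
    using suminf_split_initial_segment[OF sa, of N] by simp
  also have "\<dots> \<le> (\<Sum>i. C * x ^ (i + N))"
    by (rule norm_suminf_le) (use a sums_summable[OF tail] in auto)
  also have "\<dots> = C * x ^ N / (1 - x)" using tail by (rule sums_unique[symmetric])
  finally show "\<bar>suminf a - (\<Sum>d<N. a d)\<bar> \<le> C * x ^ N / (1 - x)" .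
qed

lemma irreducible_count_term_le:
  assumes "m \<ge> 2"
  shows "\<bar>real (irreducible_count TYPE('a::{field,finite}) d) / real CARD('a) ^ (m * d)\<bar>
           \<le> 1 * (1 / real CARD('a) ^ (m - 1)) ^ d"
proof -
  define q where "q = real CARD('a)"
  have q: "q > 0" using card_field_ge_2[where 'a = 'a] by (simp add: q_def)
  have "m * d = d + (m - 1) * d" using assms by (cases m) auto
  then have "real (irreducible_count TYPE('a) d) / q ^ (m * d)
          = real (irreducible_count TYPE('a) d) / q ^ d / q ^ ((m - 1) * d)"
    by (simp add: power_add)
  also have "\<dots> \<le> 1 / q ^ ((m - 1) * d)"
    using q irreducible_count_le[where 'a = 'a, of d]
    by (intro divide_right_mono) (auto simp: q_def divide_le_eq_1)
  finally show ?thesis using q by (simp add: q_def power_mult power_divide)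
qed

lemma inverse_card_power_le:
  assumes "m \<ge> 2"
  shows "1 / real CARD('a::{field,finite}) ^ (m - 1) \<le> 1 / 2"
proof -
  have "2 \<le> real CARD('a)" by (rule card_field_ge_2)
  also have "\<dots> = real CARD('a) ^ 1" by simp
  also have "\<dots> \<le> real CARD('a) ^ (m - 1)"
    using assms card_field_ge_2[where 'a = 'a] by (intro power_increasing) auto
  finally show ?thesis by (simp add: field_simps)
qed

text \<open>
  \<open>L m\<close> is an unordered sum over the irreducibles; grouping them by degree turns it into a series.
\<close>

lemma L_eq_suminf:
  assumes "m \<ge> 2"
  shows "L TYPE('a::{field,finite}) m
           = (\<Sum>d. real (irreducible_count TYPE('a) d) / real CARD('a) ^ (m * d))"
proof -
  define q where "q = real CARD('a)"
  define a where "a d = real (irreducible_count TYPE('a) d) / q ^ (m * d)" for d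
  define B where "B d = {l \<in> monic_irreducibles :: 'a poly set. degree l = d}" for d
  have fin: "finite (B d)" for d unfolding B_def by (rule finite_monic_irreducibles_eq)
  have q: "q > 0" using card_field_ge_2[where 'a = 'a] by (simp add: q_def)
  have "summable a"
    unfolding a_def q_def
    by (rule geometric_tail_bound(1)[OF _ _ irreducible_count_term_le[OF assms]])
       (use inverse_card_power_le[OF assms, where 'a = 'a] in auto)
  moreover have abs_a: "\<bar>a d\<bar> = a d" for d using q by (simp add: a_def)
  ultimately have hs: "(a has_sum suminf a) UNIV"
    using q by (intro norm_summable_imp_has_sum) (simp_all add: summable_sums abs_a)
  define g where "g = (\<lambda>(d::nat, l::'a poly). 1 / poly_abs l ^ m)"
  have inner: "((\<lambda>l. g (d, l)) has_sum a d) (B d)" for d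
  proof -
    have "(\<Sum>l\<in>B d. g (d, l)) = (\<Sum>l\<in>B d. 1 / q ^ (m * d))"
      by (intro sum.cong) (auto simp: g_def B_def poly_abs_def q_def mult.commute simp flip: power_mult)
    also have "\<dots> = a d" by (simp add: a_def B_def irreducible_count_def)
    finally show ?thesis using has_sum_finite[OF fin] by metis
  qed
  have "g summable_on Sigma UNIV B"
    by (rule summable_on_SigmaI[where g = a])
       (use inner hs q in \<open>auto simp: g_def poly_abs_def summable_on_def\<close>)
  then have "(g has_sum suminf a) (Sigma UNIV B)"
    using inner hs by (intro has_sum_SigmaI[where g = a]) auto
  moreover have "bij_betw (\<lambda>l. (degree l, l)) (monic_irreducibles :: 'a poly set) (Sigma UNIV B)"
    by (rule bij_betwI[of _ _ _ snd]) (auto simp: B_def)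
  ultimately have "((\<lambda>l. g (degree l, l)) has_sum suminf a) (monic_irreducibles :: 'a poly set)"
    using has_sum_reindex_bij_betw by blast
  then have "L TYPE('a) m = suminf a"
    unfolding L_def g_def by (simp add: infsumI)
  then show ?thesis by (simp add: a_def[abs_def] q_def)
qed

text \<open>
  There are no irreducibles of degree \<open>0\<close>, so the partial sum covers the degrees from \<open>1\<close> to \<open>N - 1\<close>.
\<close>

lemma L_tail:
  assumes "m \<ge> 2"
  shows "\<bar>L TYPE('a::{field,finite}) m
            - (\<Sum>d<N. real (irreducible_count TYPE('a) d) / real CARD('a) ^ (m * d))\<bar>
           \<le> 2 / real CARD('a) ^ ((m - 1) * N)"
proof -
  define x where "x = 1 / real CARD('a) ^ (m - 1)"
  have x: "0 \<le> x" "x \<le> 1 / 2"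
    using inverse_card_power_le[OF assms, where 'a = 'a] by (auto simp: x_def)
  have "\<bar>L TYPE('a) m - (\<Sum>d<N. real (irreducible_count TYPE('a) d) / real CARD('a) ^ (m * d))\<bar>
          \<le> 1 * x ^ N / (1 - x)"
    unfolding L_eq_suminf[OF assms] x_def
    by (rule geometric_tail_bound(2)[OF _ _ irreducible_count_term_le[OF assms]])
       (use x in \<open>auto simp: x_def\<close>)
  also have "\<dots> \<le> 1 * x ^ N / (1 / 2)" using x by (intro divide_left_mono) auto
  finally show ?thesis by (simp add: x_def power_divide power_mult)
qed

lemma c1_tail:
  fixes n :: nat
  defines "q \<equiv> real CARD('a::{field,finite})"
  shows "\<bar>c1 TYPE('a) - (\<Sum>i<n. (real (irreducible_count TYPE('a) (Suc i)) - q ^ Suc i / real (Suc i))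
            / q ^ Suc i)\<bar> \<le> 2 * (1 / sqrt q) ^ n / (1 - 1 / sqrt q)"
proof -
  have q: "q \<ge> 2" unfolding q_def by (rule card_field_ge_2)
  define b where "b i = (real (irreducible_count TYPE('a) (Suc i)) - q ^ Suc i / real (Suc i)) / q ^ Suc i" for i
  have s1: "sqrt q > 1" using q by simp
  have bound: "\<bar>b i\<bar> \<le> 2 * (1 / sqrt q) ^ i" for i
  proof -
    have "\<bar>b i\<bar> \<le> 2 * sqrt q ^ Suc i / q ^ Suc i"
      using irreducible_count_approx[of "Suc i", where 'a = 'a] q
      unfolding b_def abs_divide by (simp add: q_def divide_right_mono)
    also have "q ^ Suc i = sqrt q ^ Suc i * sqrt q ^ Suc i"
      using q by (simp only: power_mult_distrib[symmetric]) simp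
    also have "2 * sqrt q ^ Suc i / (sqrt q ^ Suc i * sqrt q ^ Suc i) = 2 * (1 / sqrt q) ^ Suc i"
      using s1 by (simp add: power_divide)
    also have "\<dots> \<le> 2 * (1 / sqrt q) ^ i"
      using s1 by (intro mult_left_mono power_decreasing) auto
    finally show ?thesis .
  qed
  have "c1 TYPE('a) = suminf b"
    by (simp add: c1_def b_def[abs_def] Let_def q_def)
  then show ?thesis
    using geometric_tail_bound(2)[OF _ _ bound, of n] s1 unfolding b_def[symmetric] by simp
qed

lemma harm_approx:
  assumes "n > 0"
  shows "\<bar>harm n - ln (real n) - euler_mascheroni\<bar> \<le> 1 / real n"
proof -
  have "ln (real (Suc n)) - ln (real n) = ln (1 + 1 / real n)"
    using assms ln_div[of "real (Suc n)" "real n"] by (simp add: add_divide_distrib add.commute)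
  also have "\<dots> \<le> 1 / real n" by (rule ln_add_one_self_le_self) simp
  finally have upper: "ln (real (Suc n)) \<le> ln (real n) + 1 / real n" by simp
  have lower: "ln (real n) \<le> ln (real (Suc n))" using assms by simp
  have "euler_mascheroni \<ge> harm n - ln (real (Suc n)) + inverse (real (2 * (n + 1)))"
    "euler_mascheroni \<le> harm n - ln (real (Suc n)) + inverse (real (2 * n))"
    using euler_mascheroni_bounds[of n] assms by auto
  moreover have "inverse (real (2 * n)) \<le> 1 / real n" "inverse (real (2 * (n + 1))) \<ge> 0"
    using assms by (auto simp: field_simps)
  ultimately show ?thesis using upper lower by linarith
qed

section \<open>Averages of the counting functions\<close>

lemma sum_omega:
  assumes "k \<ge> 1"
  shows "(\<Sum>f\<in>(monic_of_degree n :: 'a::{field,finite} poly set). real (omega k f))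
    = (\<Sum>d=1..n. real (irreducible_count TYPE('a) d) *
         (if k * d \<le> n then real CARD('a) ^ (n - k * d) else 0))
    - (\<Sum>d=1..n. real (irreducible_count TYPE('a) d) *
         (if Suc k * d \<le> n then real CARD('a) ^ (n - Suc k * d) else 0))"
proof -
  let ?S = "{l \<in> monic_irreducibles :: 'a poly set. degree l \<le> n}"
  let ?M = "monic_of_degree n :: 'a poly set"
  define I :: "nat \<Rightarrow> 'a poly \<Rightarrow> 'a poly \<Rightarrow> real" where "I j l f = (if l ^ j dvd f then 1 else 0)" for j l f
  have omega: "real (omega k f) = (\<Sum>l\<in>?S. I k l f - I (Suc k) l f)" if f: "f \<in> ?M" for f
  proof -
    have f0: "f \<noteq> 0" and deg: "degree f = n" using f by (auto simp: monic_of_degree_def)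
    have iff: "l ^ j dvd f \<longleftrightarrow> j \<le> nu l f" if "l \<in> monic_irreducibles" for l j
      by (rule power_dvd_iff_le_nu[OF that f0])
    have "degree l \<le> n" if l: "l \<in> monic_irreducibles" "nu l f = k" for l
      using iff[of l 1] dvd_imp_degree_le[of l f] l assms f0 deg by simp
    then have "{l \<in> monic_irreducibles. nu l f = k} = {l \<in> ?S. nu l f = k}" by auto
    then have "real (omega k f) = (\<Sum>l\<in>{l \<in> ?S. nu l f = k}. 1)"
      unfolding omega_def by simp
    also have "\<dots> = (\<Sum>l\<in>?S. if nu l f = k then 1 else 0)"
      by (rule sum.inter_filter[OF finite_monic_irreducibles_le])
    also have "\<dots> = (\<Sum>l\<in>?S. I k l f - I (Suc k) l f)"
      by (intro sum.cong refl) (auto simp: I_def iff simp del: power_Suc)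
    finally show ?thesis .
  qed
  have I: "(\<Sum>l\<in>?S. \<Sum>f\<in>?M. I j l f) = (\<Sum>d=1..n. real (irreducible_count TYPE('a) d) *
         (if j * d \<le> n then real CARD('a) ^ (n - j * d) else 0))" for j
  proof -
    have "(\<Sum>l\<in>?S. \<Sum>f\<in>?M. I j l f)
            = (\<Sum>l\<in>?S. if j * degree l \<le> n then real CARD('a) ^ (n - j * degree l) else 0)"
      unfolding I_def by (intro sum.cong refl sum_dvd_indicator) simp
    also have "\<dots> = (\<Sum>d=1..n. real (irreducible_count TYPE('a) d) *
         (if j * d \<le> n then real CARD('a) ^ (n - j * d) else 0))"
      by (rule sum_monic_irreducibles_by_degree)
    finally show ?thesis .
  qed
  have "(\<Sum>f\<in>?M. real (omega k f)) = (\<Sum>f\<in>?M. \<Sum>l\<in>?S. I k l f - I (Suc k) l f)"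
    by (intro sum.cong refl omega)
  also have "\<dots> = (\<Sum>l\<in>?S. \<Sum>f\<in>?M. I k l f - I (Suc k) l f)" by (rule sum.swap)
  also have "\<dots> = (\<Sum>l\<in>?S. \<Sum>f\<in>?M. I k l f) - (\<Sum>l\<in>?S. \<Sum>f\<in>?M. I (Suc k) l f)"
    by (simp only: sum_subtractf)
  finally show ?thesis by (simp only: I)
qed

text \<open>
  The left-hand side counts pairs of a monic irreducible \<open>l\<close> and a monic \<open>f\<close> of degree \<open>n\<close> with
  \<open>l ^ m\<close> dividing \<open>f\<close>. The added term \<open>d = 0\<close> on the right vanishes.
\<close>

lemma sum_multiples_eq:
  assumes "m \<ge> 1"
  shows "(\<Sum>d=1..n. real (irreducible_count TYPE('a::{field,finite}) d) *
            (if m * d \<le> n then real CARD('a) ^ (n - m * d) else 0))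
          = real CARD('a) ^ n *
            (\<Sum>d<Suc (n div m). real (irreducible_count TYPE('a) d) / real CARD('a) ^ (m * d))"
proof -
  define q where "q = real CARD('a)"
  define \<pi> where "\<pi> d = real (irreducible_count TYPE('a) d)" for d
  have q: "q > 0" using card_field_ge_2[where 'a = 'a] by (simp add: q_def)
  have le: "m * d \<le> n \<longleftrightarrow> d < Suc (n div m)" for d
    using assms by (simp add: less_Suc_eq_le less_eq_div_iff_mult_less_eq mult.commute)
  have "q ^ n * (\<Sum>d<Suc (n div m). \<pi> d / q ^ (m * d)) = (\<Sum>d<Suc (n div m). \<pi> d * q ^ (n - m * d))"
    unfolding sum_distrib_left
  proof (intro sum.cong refl)
    fix d assume "d \<in> {..<Suc (n div m)}"
    then have "m * d \<le> n" using le by simp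
    then have "q ^ n = q ^ (n - m * d) * q ^ (m * d)" by (simp flip: power_add)
    then show "q ^ n * (\<pi> d / q ^ (m * d)) = \<pi> d * q ^ (n - m * d)" using q by simp
  qed
  also have "\<dots> = (\<Sum>d\<in>{d \<in> {1..n}. d < Suc (n div m)}. \<pi> d * q ^ (n - m * d))"
  proof (rule sum.mono_neutral_right)
    show "{d \<in> {1..n}. d < Suc (n div m)} \<subseteq> {..<Suc (n div m)}" by auto
    have "d \<le> n" if "d < Suc (n div m)" for d
      using that div_le_dividend[of n m] by linarith
    then show "\<forall>d\<in>{..<Suc (n div m)} - {d \<in> {1..n}. d < Suc (n div m)}. \<pi> d * q ^ (n - m * d) = 0"
      by (auto simp: \<pi>_def Suc_le_eq)
  qed simp
  also have "\<dots> = (\<Sum>d=1..n. \<pi> d * (if m * d \<le> n then q ^ (n - m * d) else 0))"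
    unfolding le by (subst sum.inter_filter) (auto intro!: sum.cong)
  finally show ?thesis unfolding q_def \<pi>_def by (rule sym)
qed

lemma sum_multiples_approx:
  assumes "m \<ge> 2"
  shows "\<bar>(\<Sum>d=1..n. real (irreducible_count TYPE('a::{field,finite}) d) *
            (if m * d \<le> n then real CARD('a) ^ (n - m * d) else 0))
          - L TYPE('a) m * real CARD('a) ^ n\<bar> \<le> 2 * real CARD('a) powr (real n / real m)"
proof -
  define q where "q = real CARD('a)"
  define N where "N = Suc (n div m)"
  define S where "S = (\<Sum>d<N. real (irreducible_count TYPE('a) d) / q ^ (m * d))"
  have q: "q \<ge> 2" unfolding q_def by (rule card_field_ge_2)
  have "\<bar>q ^ n * S - L TYPE('a) m * q ^ n\<bar> = q ^ n * \<bar>L TYPE('a) m - S\<bar>"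
  proof -
    have "q ^ n * S - L TYPE('a) m * q ^ n = q ^ n * - (L TYPE('a) m - S)"
      by (simp add: algebra_simps)
    then show ?thesis using q by (simp only: abs_mult abs_minus_cancel) simp
  qed
  also have "\<dots> \<le> q ^ n * (2 / q ^ ((m - 1) * N))"
    using L_tail[OF assms, of N, where 'a = 'a] q by (intro mult_left_mono) (auto simp: S_def q_def)
  \<comment> \<open>As \<open>N > n / m\<close>, the exponent is at most \<open>n - (m - 1) * n / m = n / m\<close>.\<close>
  also have "\<dots> = 2 * q powr (real n - real ((m - 1) * N))"
    using q by (simp add: powr_diff powr_realpow del: of_nat_mult)
  also have "\<dots> \<le> 2 * q powr (real n / real m)"
  proof -
    have "n < m * N" using assms dividend_less_times_div[of m n] by (simp add: N_def)
    then have "real n \<le> real m * real N" by (metis less_imp_le of_nat_le_iff of_nat_mult)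
    then have "real n / real m \<le> real N" using assms by (simp add: field_simps)
    then have "(real m - 1) * (real n / real m) \<le> (real m - 1) * real N"
      using assms by (intro mult_left_mono) auto
    moreover have "(real m - 1) * (real n / real m) = real n - real n / real m"
      using assms by (simp add: field_simps)
    ultimately have "real n - real ((m - 1) * N) \<le> real n / real m"
      using assms by (simp add: of_nat_diff)
    then show ?thesis using q by (intro mult_left_mono powr_mono) auto
  qed
  finally show ?thesis
    using sum_multiples_eq[of m n, where 'a = 'a] assms by (simp add: S_def N_def q_def)
qed

theorem theorem1p1:
  fixes q :: real
  assumes q_def: "q = real CARD('a::{field,finite})"
  shows "((\<lambda>n. (\<Sum>f\<in>(monic_of_degree n :: 'a poly set). real (omega 1 f))
              - (q ^ n * ln (real n) + (A1 TYPE('a) - L TYPE('a) 2) * q ^ n))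
           \<in> O(\<lambda>n. q ^ n / real n)) \<and>
         (\<forall>k\<ge>2. (\<lambda>n. (\<Sum>f\<in>(monic_of_degree n :: 'a poly set). real (omega k f))
              - (L TYPE('a) k - L TYPE('a) (k + 1)) * q ^ n)
           \<in> O(\<lambda>n. real n * q powr (real n / real k)))"
proof (intro conjI allI impI)
  have q: "q \<ge> 2" unfolding q_def by (rule card_field_ge_2)
  define E where "E m n = (\<Sum>d=1..n. real (irreducible_count TYPE('a) d) *
            (if m * d \<le> n then q ^ (n - m * d) else 0))" for m n
  have omega: "(\<Sum>f\<in>(monic_of_degree n :: 'a poly set). real (omega k f)) = E k n - E (Suc k) n"
    if "k \<ge> 1" for k n
    using sum_omega[OF that, of n, where 'a = 'a] by (simp only: E_def q_def)
  have E: "\<bar>E m n - L TYPE('a) m * q ^ n\<bar> \<le> 2 * q powr (real n / real m)" if "m \<ge> 2" for m n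
    using sum_multiples_approx[OF that, of n, where 'a = 'a] by (simp only: E_def q_def)
  show "(\<lambda>n. (\<Sum>f\<in>(monic_of_degree n :: 'a poly set). real (omega k f))
              - (L TYPE('a) k - L TYPE('a) (k + 1)) * q ^ n)
           \<in> O(\<lambda>n. real n * q powr (real n / real k))" if k: "k \<ge> 2" for k
  proof (rule bigoI[where c = 4], rule eventually_mono[OF eventually_gt_at_top[of 0]])
    fix n :: nat assume n: "n > 0"
    have "q powr (real n / real (Suc k)) \<le> q powr (real n / real k)"
      using q k n by (intro powr_mono divide_left_mono) auto
    then have "\<bar>E k n - E (Suc k) n - (L TYPE('a) k - L TYPE('a) (Suc k)) * q ^ n\<bar>
            \<le> 4 * q powr (real n / real k)"
      using E[of k n] E[of "Suc k" n] k unfolding left_diff_distrib by linarith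
    also have "\<dots> \<le> 4 * (real n * q powr (real n / real k))"
      using mult_right_mono[of 1 "real n" "q powr (real n / real k)"] n by simp
    finally show "norm ((\<Sum>f\<in>(monic_of_degree n :: 'a poly set). real (omega k f))
              - (L TYPE('a) k - L TYPE('a) (k + 1)) * q ^ n)
          \<le> 4 * norm (real n * q powr (real n / real k))"
      using k by (simp add: omega)
  qed
  have omega1: "(\<Sum>f\<in>(monic_of_degree n :: 'a poly set). real (omega 1 f)) = E 1 n - E 2 n" for n
    using omega[of 1 n] by (simp only: Suc_1 order_refl simp_thms)
  define s where "s = sqrt q"
  have s: "s > 1" "q = s ^ 2" using q by (auto simp: s_def)
  \<comment> \<open>\<open>C\<close> adds the constants of the tails of the series for \<open>c1\<close> and \<open>L 2\<close>, both of order \<open>s\<close>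
    to the power \<open>- n\<close>.\<close>
  define C where "C = 2 / (1 - 1 / s) + 2"
  have C: "C \<ge> 0" using s by (simp add: C_def)
  show "(\<lambda>n. (\<Sum>f\<in>(monic_of_degree n :: 'a poly set). real (omega 1 f))
              - (q ^ n * ln (real n) + (A1 TYPE('a) - L TYPE('a) 2) * q ^ n))
           \<in> O(\<lambda>n. q ^ n / real n)"
  proof (rule bigoI[where c = "1 + C / (s - 1)"], rule eventually_mono[OF eventually_gt_at_top[of 0]])
    fix n :: nat assume n: "n > 0"
    define h where "h = harm n - ln (real n) - (euler_mascheroni :: real)"
    define b where "b i = (real (irreducible_count TYPE('a) (Suc i)) - q ^ Suc i / real (Suc i)) / q ^ Suc i" for i
    \<comment> \<open>Bernoulli's inequality turns the geometric decay into the rate \<open>1 / n\<close>.\<close>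
    have "real n * (s - 1) \<le> (1 + (s - 1)) ^ n"
      using Bernoulli_inequality[of "s - 1" n] s by simp
    then have "(1 / s) ^ n \<le> 1 / (real n * (s - 1))"
      using s n by (simp add: power_divide frac_le)
    then have "C * (1 / s) ^ n \<le> C * (1 / (real n * (s - 1)))"
      using C by (rule mult_left_mono)
    then have decay: "C * (1 / s) ^ n \<le> C / (s - 1) / real n"
      by (simp add: mult.commute)
    have "E 1 n = q ^ n * (\<Sum>d<Suc n. real (irreducible_count TYPE('a) d) / q ^ d)"
      using sum_multiples_eq[of 1 n, where 'a = 'a] by (simp only: E_def q_def) simp
    also have "(\<Sum>d<Suc n. real (irreducible_count TYPE('a) d) / q ^ d)
                 = (\<Sum>i<n. real (irreducible_count TYPE('a) (Suc i)) / q ^ Suc i)"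
      by (subst sum.lessThan_Suc_shift) simp
    also have "\<dots> = (\<Sum>i<n. b i + 1 / real (Suc i))"
      using q by (intro sum.cong refl) (simp add: b_def diff_divide_distrib)
    also have "\<dots> = (\<Sum>i<n. b i) + harm n"
      by (simp add: sum.distrib harm_altdef inverse_eq_divide)
    finally have E1: "E 1 n = q ^ n * ((\<Sum>i<n. b i) + harm n)" .
    have "\<bar>c1 TYPE('a) - (\<Sum>i<n. b i)\<bar> \<le> 2 / (1 - 1 / s) * (1 / s) ^ n"
      using c1_tail[of n, where 'a = 'a] by (simp add: b_def q_def s_def mult.commute)
    then have c1: "q ^ n * \<bar>c1 TYPE('a) - (\<Sum>i<n. b i)\<bar> \<le> q ^ n * (2 / (1 - 1 / s) * (1 / s) ^ n)"
      using q by (intro mult_left_mono) auto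
    have h: "q ^ n * \<bar>h\<bar> \<le> q ^ n * (1 / real n)"
      using q harm_approx[OF n] by (intro mult_left_mono) (auto simp: h_def)
    have "q powr (real n / real 2) = s ^ n"
    proof -
      have "q powr (real n / 2) = (q powr (1 / 2)) powr real n" by (simp add: powr_powr)
      also have "\<dots> = s ^ n" using q by (simp add: s_def powr_half_sqrt powr_realpow)
      finally show ?thesis by simp
    qed
    also have "\<dots> = q ^ n * (1 / s) ^ n"
      using s by (simp add: power_divide power2_eq_square power_mult_distrib)
    finally have L2: "\<bar>E 2 n - L TYPE('a) 2 * q ^ n\<bar> \<le> q ^ n * (2 * (1 / s) ^ n)"
      using E[of 2 n] by simp
    have "E 1 n - E 2 n - (q ^ n * ln (real n) + (A1 TYPE('a) - L TYPE('a) 2) * q ^ n)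
        = q ^ n * h - q ^ n * (c1 TYPE('a) - (\<Sum>i<n. b i)) - (E 2 n - L TYPE('a) 2 * q ^ n)"
      unfolding E1 h_def A1_def by (simp add: algebra_simps)
    also have "\<bar>\<dots>\<bar> \<le> q ^ n * \<bar>h\<bar> + q ^ n * \<bar>c1 TYPE('a) - (\<Sum>i<n. b i)\<bar> + \<bar>E 2 n - L TYPE('a) 2 * q ^ n\<bar>"
    proof -
      have "\<bar>u - v - w\<bar> \<le> \<bar>u\<bar> + \<bar>v\<bar> + \<bar>w\<bar>" for u v w :: real by linarith
      from this[of "q ^ n * h" "q ^ n * (c1 TYPE('a) - (\<Sum>i<n. b i))"] show ?thesis
        using q by (simp only: abs_mult power_abs[symmetric]) simp
    qed
    also have "\<dots> \<le> q ^ n * (1 / real n) + q ^ n * (2 / (1 - 1 / s) * (1 / s) ^ n) + q ^ n * (2 * (1 / s) ^ n)"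
      by (intro add_mono h c1 L2)
    also have "\<dots> = q ^ n * (1 / real n + C * (1 / s) ^ n)"
      by (simp add: C_def algebra_simps)
    also have "\<dots> \<le> q ^ n * (1 / real n + C / (s - 1) / real n)"
      using q by (intro mult_left_mono add_left_mono decay) auto
    also have "\<dots> = (1 + C / (s - 1)) * (q ^ n / real n)"
      by (simp add: algebra_simps add_divide_distrib)
    finally have main: "\<bar>E 1 n - E 2 n - (q ^ n * ln (real n) + (A1 TYPE('a) - L TYPE('a) 2) * q ^ n)\<bar>
        \<le> (1 + C / (s - 1)) * (q ^ n / real n)" .
    have "norm (q ^ n / real n) = q ^ n / real n" using q by simp
    with main show "norm ((\<Sum>f\<in>(monic_of_degree n :: 'a poly set). real (omega 1 f))
              - (q ^ n * ln (real n) + (A1 TYPE('a) - L TYPE('a) 2) * q ^ n))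
          \<le> (1 + C / (s - 1)) * norm (q ^ n / real n)"
      by (simp only: omega1 real_norm_def)
  qed
qed

end
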